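(* Let $a\in\mathbb{R}$ with $3/2<a\le 2$ and let $t$ be a positive integer. For every $\beta>0$ there exist $\gamma>0$ and $n_0$ such that every $T_3^t$-free digraph $G$ on $n\ge n_0$ vertices with \[\Big|e_a(G)-a\cdot\frac{1}{2}\cdot\frac{n^2}{2}\Big|\le\gamma n^2\] satisfies $G=DTu_2(n)\pm\beta n^2$, i.e. there is a partition of $V(G)$ into two parts of sizes $\lfloor n/2\rfloor$ and $\lceil n/2\rceil$ such that $G$ can be transformed into the digraph having a double edge between every pair of vertices in different parts and no other edges by adding or deleting at most $\beta n^2$ edges.
   Context: A digraph has edges as ordered pairs of distinct vertices; a double edge is a pair $u,v$ with both $uv$ and $vu$ present. $f_1(G)$ is the number of unordered pairs $\{u,v\}$ with exactly one of $uv,vu$ an edge, $f_2(G)$ the number of double edges, and $e_a(G)=af_2(G)+f_1(G)$. $T_3$ is the transitive tournament on 3 vertices; for a digraph $H$ and positive integer $t$, the blow-up $H^t$ replaces each vertex $v$ by an independent set $S_v$ of $t$ vertices and each edge $uv$ by all edges from $S_u$ to $S_v$. $G$ is $T_3^t$-free if it has no sub-digraph isomorphic to $T_3^t$. $DTu_2(n)$ is the digraph obtained from the balanced complete bipartite graph on $n$ vertices by replacing each edge by a double edge. *)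

theory Defs
  imports
    Complex_Main
    "Graph_Theory.Pair_Digraph"
    "Graph_Theory.Digraph_Component"
    "Graph_Theory.Digraph_Isomorphism"
begin

definition f1 :: "'a pair_pre_digraph \<Rightarrow> nat" where
  "f1 G = card {{u, v} | u v. u \<in> pverts G \<and> v \<in> pverts G \<and> u \<noteq> v \<and>
     ((u, v) \<in> parcs G \<longleftrightarrow> (v, u) \<notin> parcs G)}"

definition f2 :: "'a pair_pre_digraph \<Rightarrow> nat" where
  "f2 G = card {{u, v} | u v. u \<in> pverts G \<and> v \<in> pverts G \<and> u \<noteq> v \<and>
     (u, v) \<in> parcs G \<and> (v, u) \<in> parcs G}"

definition e_weight :: "real \<Rightarrow> 'a pair_pre_digraph \<Rightarrow> real" where
  "e_weight a G = a * real (f2 G) + real (f1 G)"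

definition T3 :: "nat pair_pre_digraph" where
  "T3 = \<lparr> pverts = {0, 1, 2}, parcs = {(0, 1), (0, 2), (1, 2)} \<rparr>"

definition blow_up :: "'a pair_pre_digraph \<Rightarrow> nat \<Rightarrow> ('a \<times> nat) pair_pre_digraph" where
  "blow_up H t = \<lparr> pverts = pverts H \<times> {..<t},
     parcs = {((u, i), (v, j)) | u v i j. (u, v) \<in> parcs H \<and> i < t \<and> j < t} \<rparr>"

text \<open>Sub-digraphs are not required to be induced.\<close>

definition contains_copy :: "'a pair_pre_digraph \<Rightarrow> 'b pair_pre_digraph \<Rightarrow> bool" where
  "contains_copy G F \<longleftrightarrow> (\<exists>H :: 'a pair_pre_digraph.
     subgraph (with_proj H) (with_proj G) \<and> digraph_iso (with_proj F) (with_proj H))"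

text \<open>
  For disjoint \<open>A\<close> and \<open>B\<close> of sizes \<open>\<lfloor>n/2\<rfloor>\<close> and \<open>\<lceil>n/2\<rceil>\<close> this is the copy
  of \<open>DTu\<^sub>2(n)\<close> with parts \<open>A\<close> and \<open>B\<close>.
\<close>

definition double_bipartite :: "'a set \<Rightarrow> 'a set \<Rightarrow> 'a pair_pre_digraph" where
  "double_bipartite A B = \<lparr> pverts = A \<union> B, parcs = A \<times> B \<union> B \<times> A \<rparr>"

text \<open>
  The number of edges that have to be added or deleted to turn \<open>G\<close> into \<open>H\<close>, for digraphs
  on the same finite vertex set. Edges are ordered pairs, so a double edge counts twice.
\<close>

definition edit_distance :: "'a pair_pre_digraph \<Rightarrow> 'a pair_pre_digraph \<Rightarrow> nat" where
  "edit_distance G H = card ((parcs G - parcs H) \<union> (parcs H - parcs G))"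

text \<open>\<open>G = DTu\<^sub>2(n) \<plusminus> r\<close>, where \<open>n\<close> is the number of vertices of \<open>G\<close>.\<close>

definition near_DTu2 :: "'a pair_pre_digraph \<Rightarrow> real \<Rightarrow> bool" where
  "near_DTu2 G r \<longleftrightarrow> (\<exists>A B. A \<union> B = pverts G \<and> A \<inter> B = {} \<and>
     int (card A) = \<lfloor>real (card (pverts G)) / 2\<rfloor> \<and>
     int (card B) = \<lceil>real (card (pverts G)) / 2\<rceil> \<and>
     real (edit_distance G (double_bipartite A B)) \<le> r)"

end

theory Submission
  imports Defs
begin

text \<open>
  A pigeonhole argument shows that a \<open>T\<^sub>3\<^sup>t\<close>-free digraph has only \<open>o(n\<^sup>3)\<close> transitive triangles.
  Discarding the few pairs of vertices that lie in many of them makes every remaining arc lie in at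
  most \<open>c = \<tau> n\<close> transitive triangles, which replaces an appeal to the removal lemma.

  Give a double edge weight 3 and a single arc weight 2. Two ends of a double edge, or else the
  vertices of a cyclic triangle, or else the two ends of an arc, have on average weighted degree at
  most \<open>3/2 |W| + 2 c\<close> inside \<open>W\<close>; deleting a vertex of small weighted degree repeatedly bounds the
  total weight by essentially \<open>3/4 n\<^sup>2\<close>. Since \<open>a > 3/2\<close>, an almost extremal value of \<open>e\<^sub>a\<close> then
  forces almost \<open>n\<^sup>2/4\<close> double edges and almost no single arcs. Furedi's argument, which splits the
  vertices into the neighbourhood of a vertex of maximum degree and the rest, shows that the
  graph of double edges is nearly bipartite and nearly balanced.
\<close>

subsection \<open>Counting transitive triangles\<close>

text \<open>Copies need not be induced, so the image of \<open>F\<close> under an injective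
  arc-preserving map already serves as the subgraph.\<close>

lemma contains_copyI:
  assumes "pair_wf_digraph F" "pair_wf_digraph G" "inj_on h (pverts F)" "h ` pverts F \<subseteq> pverts G"
    and "\<And>u v. (u, v) \<in> parcs F \<Longrightarrow> (h u, h v) \<in> parcs G"
  shows "contains_copy G F"
proof -
  define H where "H = \<lparr>pverts = h ` pverts F, parcs = map_prod h h ` parcs F\<rparr>"
  interpret F: pair_wf_digraph F by fact
  interpret G: pair_wf_digraph G by fact
  have wfH: "pair_wf_digraph H"
    by unfold_locales (auto simp: H_def dest: F.in_arcsD1 F.in_arcsD2)
  have "subgraph (with_proj H) (with_proj G)"
    using assms wfH by (auto simp: subgraph_def H_def wf_digraph_wp_iff)
  moreover have "digraph_iso (with_proj F) (with_proj H)"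
    unfolding digraph_iso_def
  proof (intro exI conjI)
    let ?f = "\<lparr>iso_verts = h, iso_arcs = map_prod h h, iso_head = snd, iso_tail = fst\<rparr>"
    have "inj_on (map_prod h h) (parcs F)"
      by (rule inj_on_subset[OF map_prod_inj_on[OF assms(3,3)]]) (auto dest: F.in_arcsD1 F.in_arcsD2)
    then show "pre_digraph.digraph_isomorphism (with_proj F) ?f"
      using assms by (auto simp: pre_digraph.digraph_isomorphism_def wf_digraph_wp_iff)
    show "with_proj H = app_iso ?f (with_proj F)"
      by (simp add: with_proj_def app_iso_def H_def)
  qed
  ultimately show ?thesis unfolding contains_copy_def by blast
qed

lemma contains_blow_up_T3:
  assumes "pair_digraph G" and S: "S0 \<subseteq> pverts G" "S1 \<subseteq> pverts G" "S2 \<subseteq> pverts G"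
    and card: "card S0 = t" "card S1 = t" "card S2 = t"
    and arcs: "S0 \<times> S1 \<subseteq> parcs G" "S0 \<times> S2 \<subseteq> parcs G" "S1 \<times> S2 \<subseteq> parcs G"
  shows "contains_copy G (blow_up T3 t)"
proof -
  interpret G: pair_digraph G by fact
  have fin: "finite S0" "finite S1" "finite S2"
    using S G.pair_finite_verts by (auto intro: finite_subset)
  from ex_bij_betw_nat_finite[OF fin(1)] card obtain g0 where g0: "bij_betw g0 {..<t} S0"
    by (auto simp: atLeast0LessThan)
  from ex_bij_betw_nat_finite[OF fin(2)] card obtain g1 where g1: "bij_betw g1 {..<t} S1"
    by (auto simp: atLeast0LessThan)
  from ex_bij_betw_nat_finite[OF fin(3)] card obtain g2 where g2: "bij_betw g2 {..<t} S2"
    by (auto simp: atLeast0LessThan)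
  \<comment> \<open>A vertex common to two of the sets would carry a loop, since all arcs between
    the sets are present.\<close>
  have disj: "S0 \<inter> S1 = {}" "S0 \<inter> S2 = {}" "S1 \<inter> S2 = {}"
    using arcs G.pair_no_loops by fastforce+
  define h where "h = (\<lambda>(i::nat, j). if i = 0 then g0 j else if i = 1 then g1 j else g2 j)"
  have in_S: "g0 j \<in> S0" "g1 j \<in> S1" "g2 j \<in> S2" if "j < t" for j
    using g0 g1 g2 that by (auto simp: bij_betw_def)
  show ?thesis
  proof (rule contains_copyI[where h = h])
    show "pair_wf_digraph (blow_up T3 t)"
      by unfold_locales (auto simp: blow_up_def T3_def)
    show "pair_wf_digraph G" by unfold_locales
    show "inj_on h (pverts (blow_up T3 t))"
    proof (rule inj_onI)
      fix x y assume xy: "x \<in> pverts (blow_up T3 t)" "y \<in> pverts (blow_up T3 t)" "h x = h y"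
      obtain i j k l where [simp]: "x = (i, j)" "y = (k, l)" by fastforce
      have jl: "j < t" "l < t" "i \<in> {0, 1, 2}" "k \<in> {0, 1, 2}"
        using xy by (auto simp: blow_up_def T3_def)
      note inS = in_S[OF jl(1)] in_S[OF jl(2)]
      have ik: "i = k"
        using jl xy(3) inS disj by (auto simp: h_def disjoint_iff split: if_splits)
      moreover have "j = l"
        using jl xy(3) ik bij_betw_imp_inj_on[OF g0] bij_betw_imp_inj_on[OF g1] bij_betw_imp_inj_on[OF g2]
        by (auto simp: h_def inj_on_def)
      ultimately show "x = y" by simp
    qed
    show "h ` pverts (blow_up T3 t) \<subseteq> pverts G"
      using in_S S by (auto simp: blow_up_def T3_def h_def)
    show "(h u, h v) \<in> parcs G" if "(u, v) \<in> parcs (blow_up T3 t)" for u v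
      using that in_S arcs by (auto simp: blow_up_def T3_def h_def)
  qed
qed

text \<open>Elements of value below \<open>\<delta> / 2 * M\<close> supply at most half of the
  required sum. The other half comes from elements worth at most \<open>M\<close> each, so these
  make up at least a \<open>\<delta> / 2\<close> share of \<open>A\<close>.\<close>

lemma reverse_Markov:
  fixes f :: "'a \<Rightarrow> real"
  assumes fin: "finite A" and M: "M > 0" "\<And>x. x \<in> A \<Longrightarrow> f x \<le> M"
    and \<delta>: "\<delta> > 0" "\<delta> * M * card A \<le> sum f A"
  shows "\<delta> / 2 * card A \<le> card {x \<in> A. \<delta> / 2 * M \<le> f x}"
proof -
  let ?P = "{x \<in> A. \<delta> / 2 * M \<le> f x}"
  have "sum f A \<le> (\<Sum>x\<in>A. \<delta> / 2 * M + (if \<delta> / 2 * M \<le> f x then M else 0))"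
    using M \<delta> by (intro sum_mono) (auto simp: add_increasing)
  also have "\<dots> = \<delta> / 2 * M * card A + M * card ?P"
    using fin by (simp add: sum.distrib flip: sum.inter_filter)
  finally have "M * (\<delta> / 2 * card A) \<le> M * card ?P" using \<delta> by (simp add: algebra_simps)
  then show ?thesis using M by simp
qed

text \<open>Fix boundedly many elements of \<open>X\<close> of large degree. By double counting, a
  fixed share of \<open>Y\<close> sees at least \<open>t\<close> of them, and by pigeonhole one
  \<open>t\<close>-subset is seen by a fixed share of \<open>Y\<close>. The two types differ so that
  \<open>Y\<close> can also consist of pairs.\<close>

lemma ex_common_neighbours:
  fixes \<delta> :: real and t :: nat
  assumes \<delta>: "\<delta> > 0"
  obtains \<epsilon> :: real and n0 :: nat where "\<epsilon> > 0"
    and "\<And>(X :: 'a set) (Y :: 'b set) R. \<lbrakk>finite X; finite Y; card X \<ge> n0; card Y > 0;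
      \<delta> * card X * card Y \<le> card (R \<inter> X \<times> Y)\<rbrakk> \<Longrightarrow>
      \<exists>S\<subseteq>X. card S = t \<and> \<epsilon> * card Y \<le> card {y \<in> Y. \<forall>x\<in>S. (x, y) \<in> R}"
proof -
  \<comment> \<open>\<open>m\<close> gives \<open>t \<le> \<delta> / 4 * m\<close>,
    \<open>n0\<close> guarantees \<open>m\<close> elements of large degree, and
    \<open>\<epsilon>\<close> divides the share \<open>\<delta> / 4\<close> among the at most
    \<open>2 ^ m\<close> subsets of an \<open>m\<close>-set.\<close>
  define m :: nat where "m = nat \<lceil>4 * t / \<delta>\<rceil> + 1"
  define n0 :: nat where "n0 = nat \<lceil>2 * m / \<delta>\<rceil>"
  define \<epsilon> where "\<epsilon> = \<delta> / 4 / 2 ^ m"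
  have m: "real m \<ge> 4 * t / \<delta>" "m > 0" unfolding m_def by linarith+
  show thesis
  proof (rule that[of \<epsilon> n0])
    show "\<epsilon> > 0" using \<delta> by (simp add: \<epsilon>_def)
    note \<epsilon> = this
    fix X :: "'a set" and Y :: "'b set" and R
    assume fin: "finite X" "finite Y" and X: "card X \<ge> n0" and Y: "card Y > 0"
      and R: "\<delta> * card X * card Y \<le> card (R \<inter> X \<times> Y)"
    have "R \<inter> X \<times> Y = Sigma X (\<lambda>x. {y \<in> Y. (x, y) \<in> R})" by auto
    then have "card (R \<inter> X \<times> Y) = (\<Sum>x\<in>X. card {y \<in> Y. (x, y) \<in> R})"
      using fin by simp
    then have "\<delta> * card Y * card X \<le> (\<Sum>x\<in>X. real (card {y \<in> Y. (x, y) \<in> R}))"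
      using R by (simp add: ac_simps)
    from reverse_Markov[OF fin(1) _ _ \<delta> this]
    have "\<delta> / 2 * card X \<le> card {x \<in> X. \<delta> / 2 * card Y \<le> card {y \<in> Y. (x, y) \<in> R}}"
      using Y fin by (simp add: card_mono)
    moreover have "real m \<le> \<delta> / 2 * card X"
    proof -
      have "2 * m / \<delta> \<le> card X" using X unfolding n0_def by linarith
      then show ?thesis using \<delta> by (simp add: field_simps)
    qed
    ultimately have "m \<le> card {x \<in> X. \<delta> / 2 * card Y \<le> card {y \<in> Y. (x, y) \<in> R}}" by linarith
    \<comment> \<open>The size of \<open>M\<close> does not depend on \<open>X\<close>, so there are boundedly many candidates for \<open>S\<close>.\<close>
    then obtain M where M: "M \<subseteq> {x \<in> X. \<delta> / 2 * card Y \<le> card {y \<in> Y. (x, y) \<in> R}}" "card M = m"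
      by (meson obtain_subset_with_card_n)
    have finM: "finite M" using M m(2) by (metis card.infinite not_gr_zero)
    \<comment> \<open>Counting related pairs from both sides, elements of \<open>Y\<close> have on
      average at least \<open>\<delta> / 2 * m\<close> partners in \<open>M\<close>, so
      \<open>reverse_Markov\<close> applies a second time, with \<open>\<delta> / 2\<close>.\<close>
    have "\<delta> / 2 * m * card Y = (\<Sum>x\<in>M. \<delta> / 2 * card Y)" using M(2) by simp
    also have "\<dots> \<le> (\<Sum>x\<in>M. real (card {y \<in> Y. (x, y) \<in> R}))"
      using M(1) by (intro sum_mono) auto
    also have "\<dots> = (\<Sum>y\<in>Y. real (card {x \<in> M. (x, y) \<in> R}))"
      using sum_multicount_gen[of M Y "\<lambda>x y. (x, y) \<in> R" "\<lambda>y. card {x \<in> M. (x, y) \<in> R}"] finM fin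
      by (simp flip: of_nat_sum)
    finally have "\<delta> / 2 * m * card Y \<le> \<dots>" .
    moreover have "card {x \<in> M. (x, y) \<in> R} \<le> m" for y
      using M(2) finM card_mono[of M "{x \<in> M. (x, y) \<in> R}"] by auto
    ultimately have "\<delta> / 4 * card Y \<le> card {y \<in> Y. \<delta> / 4 * m \<le> card {x \<in> M. (x, y) \<in> R}}"
      using reverse_Markov[of Y "real m" "\<lambda>y. card {x \<in> M. (x, y) \<in> R}" "\<delta> / 2"] m(2) \<delta> fin
      by simp
    also have "\<dots> \<le> card {y \<in> Y. t \<le> card {x \<in> M. (x, y) \<in> R}}"
    proof -
      have "real t \<le> \<delta> / 4 * m" using m(1) \<delta> by (simp add: field_simps)
      then have "{y \<in> Y. \<delta> / 4 * m \<le> card {x \<in> M. (x, y) \<in> R}} \<subseteq> {y \<in> Y. t \<le> card {x \<in> M. (x, y) \<in> R}}"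
        by auto
      then show ?thesis using fin by (simp add: card_mono)
    qed
    finally have pop: "\<delta> / 4 * card Y \<le> card {y \<in> Y. t \<le> card {x \<in> M. (x, y) \<in> R}}" .
    let ?T = "{S. S \<subseteq> M \<and> card S = t}" and ?C = "\<lambda>S. {y \<in> Y. \<forall>x\<in>S. (x, y) \<in> R}"
    have finT: "finite ?T" using finM by simp
    have cardT: "card ?T \<le> 2 ^ m"
    proof -
      have "card ?T \<le> card (Pow M)" using finM by (intro card_mono) auto
      then show ?thesis using M(2) finM by (simp add: card_Pow)
    qed
    then have real_cardT: "real (card ?T) \<le> 2 ^ m"
      by (metis of_nat_le_iff of_nat_numeral of_nat_power)
    have "{y \<in> Y. t \<le> card {x \<in> M. (x, y) \<in> R}} \<subseteq> (\<Union>S\<in>?T. ?C S)"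
    proof
      fix y assume y: "y \<in> {y \<in> Y. t \<le> card {x \<in> M. (x, y) \<in> R}}"
      then obtain S where "S \<subseteq> {x \<in> M. (x, y) \<in> R}" "card S = t"
        by (auto intro: obtain_subset_with_card_n)
      then show "y \<in> (\<Union>S\<in>?T. ?C S)" using y by blast
    qed
    then have "card {y \<in> Y. t \<le> card {x \<in> M. (x, y) \<in> R}} \<le> card (\<Union>S\<in>?T. ?C S)"
      using finT fin by (intro card_mono) auto
    also have "\<dots> \<le> (\<Sum>S\<in>?T. card (?C S))" by (rule card_UN_le[OF finT])
    finally have sum: "\<delta> / 4 * card Y \<le> (\<Sum>S\<in>?T. real (card (?C S)))"
      using pop by (simp flip: of_nat_sum)
    have "\<exists>S\<in>?T. \<epsilon> * card Y \<le> card (?C S)"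
    proof (rule ccontr)
      assume "\<not> ?thesis"
      then have less: "\<And>S. S \<in> ?T \<Longrightarrow> real (card (?C S)) < \<epsilon> * card Y" by (auto simp: not_le)
      have "?T \<noteq> {}"
      proof
        assume T: "?T = {}"
        have "\<delta> / 4 * card Y \<le> 0" using sum unfolding T by simp
        then show False using \<delta> Y by (simp add: mult_le_0_iff)
      qed
      then have "(\<Sum>S\<in>?T. real (card (?C S))) < (\<Sum>S\<in>?T. \<epsilon> * card Y)"
        using less finT by (intro sum_strict_mono) auto
      also have "\<dots> \<le> 2 ^ m * (\<epsilon> * card Y)"
        using real_cardT \<epsilon> by (simp add: mult_right_mono)
      also have "\<dots> = \<delta> / 4 * card Y" by (simp add: \<epsilon>_def)
      finally show False using sum by simp
    qed
    then show "\<exists>S\<subseteq>X. card S = t \<and> \<epsilon> * card Y \<le> card (?C S)"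
      using M(1) by blast
  qed
qed

text \<open>Triples are ordered as source, middle, sink; with double edges the same three vertices
  can yield several triples.\<close>

definition tri :: "('a \<times> 'a) set \<Rightarrow> ('a \<times> 'a \<times> 'a) set" where
  "tri E = {(x, y, z). (x, y) \<in> E \<and> (x, z) \<in> E \<and> (y, z) \<in> E}"

text \<open>If there are many triangles, the classes of a blow-up can be found one after another:
  first \<open>t\<close> sources with many common (middle, sink) pairs, then, in the relation formed
  by these pairs, \<open>t\<close> middles with many common sinks.\<close>

lemma few_transitive_triangles:
  fixes \<delta> :: real and t :: nat
  assumes \<delta>: "\<delta> > 0" and t: "t > 0"
  obtains n0 :: nat where
    "\<And>G :: 'a pair_pre_digraph. \<lbrakk>pair_digraph G; card (pverts G) \<ge> n0; \<not> contains_copy G (blow_up T3 t)\<rbrakk>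
      \<Longrightarrow> card (tri (parcs G)) \<le> \<delta> * card (pverts G) ^ 3"
proof -
  obtain \<epsilon>1 :: real and n1 where \<epsilon>1: "\<epsilon>1 > 0" and step1:
    "\<And>(X :: 'a set) (Y :: ('a \<times> 'a) set) R. \<lbrakk>finite X; finite Y; card X \<ge> n1; card Y > 0;
      \<delta> * card X * card Y \<le> card (R \<inter> X \<times> Y)\<rbrakk> \<Longrightarrow>
      \<exists>S\<subseteq>X. card S = t \<and> \<epsilon>1 * card Y \<le> card {y \<in> Y. \<forall>x\<in>S. (x, y) \<in> R}"
    by (rule ex_common_neighbours[OF \<delta>, where t = t]) (rule that)
  obtain \<epsilon>2 :: real and n2 where \<epsilon>2: "\<epsilon>2 > 0" and step2:
    "\<And>(X :: 'a set) (Y :: 'a set) R. \<lbrakk>finite X; finite Y; card X \<ge> n2; card Y > 0;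
      \<epsilon>1 * card X * card Y \<le> card (R \<inter> X \<times> Y)\<rbrakk> \<Longrightarrow>
      \<exists>S\<subseteq>X. card S = t \<and> \<epsilon>2 * card Y \<le> card {y \<in> Y. \<forall>x\<in>S. (x, y) \<in> R}"
    by (rule ex_common_neighbours[OF \<epsilon>1, where t = t]) (rule that)
  \<comment> \<open>The term with \<open>t / \<epsilon>2\<close> leaves room for \<open>t\<close>
    sinks at the end; the summand 1 makes the vertex set nonempty.\<close>
  define n0 where "n0 = n1 + n2 + nat \<lceil>t / \<epsilon>2\<rceil> + 1"
  show thesis
  proof (rule that[of n0], rule ccontr)
    fix G :: "'a pair_pre_digraph"
    assume G: "pair_digraph G" and n: "card (pverts G) \<ge> n0" and free: "\<not> contains_copy G (blow_up T3 t)"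
      and many: "\<not> card (tri (parcs G)) \<le> \<delta> * card (pverts G) ^ 3"
    interpret G: pair_digraph G by fact
    let ?V = "pverts G" and ?E = "parcs G"
    have fin: "finite ?V" by (rule G.pair_finite_verts)
    have sub: "tri ?E \<inter> ?V \<times> (?V \<times> ?V) = tri ?E"
      by (auto simp: tri_def dest: G.in_arcsD1 G.in_arcsD2)
    have "\<exists>S\<subseteq>?V. card S = t \<and> \<epsilon>1 * card (?V \<times> ?V) \<le> card {y \<in> ?V \<times> ?V. \<forall>x\<in>S. (x, y) \<in> tri ?E}"
      by (rule step1) (use fin n many in \<open>auto simp: n0_def sub card_cartesian_product power3_eq_cube\<close>)
    then obtain S0 where S0: "S0 \<subseteq> ?V" "card S0 = t"
      and C0: "\<epsilon>1 * card (?V \<times> ?V) \<le> card {y \<in> ?V \<times> ?V. \<forall>x\<in>S0. (x, y) \<in> tri ?E}" by auto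
    let ?R = "{y \<in> ?V \<times> ?V. \<forall>x\<in>S0. (x, y) \<in> tri ?E}"
    have sub': "?R \<inter> ?V \<times> ?V = ?R" by auto
    have "\<exists>S\<subseteq>?V. card S = t \<and> \<epsilon>2 * card ?V \<le> card {y \<in> ?V. \<forall>x\<in>S. (x, y) \<in> ?R}"
      by (rule step2, unfold sub') (use fin n C0 in \<open>auto simp: n0_def card_cartesian_product\<close>)
    then obtain S1 where S1: "S1 \<subseteq> ?V" "card S1 = t"
      and C1: "\<epsilon>2 * card ?V \<le> card {y \<in> ?V. \<forall>x\<in>S1. (x, y) \<in> ?R}" by auto
    have "t / \<epsilon>2 \<le> card ?V" using n unfolding n0_def by linarith
    then have "real t \<le> \<epsilon>2 * card ?V" using \<epsilon>2 by (simp add: field_simps)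
    with C1 have "t \<le> card {y \<in> ?V. \<forall>x\<in>S1. (x, y) \<in> ?R}" by linarith
    then obtain S2 where S2: "S2 \<subseteq> {y \<in> ?V. \<forall>x\<in>S1. (x, y) \<in> ?R}" "card S2 = t"
      by (meson obtain_subset_with_card_n)
    have key: "(x, y) \<in> ?E \<and> (x, z) \<in> ?E \<and> (y, z) \<in> ?E" if "x \<in> S0" "y \<in> S1" "z \<in> S2" for x y z
      using that S2(1) by (auto simp: tri_def)
    \<comment> \<open>An arc between two classes is read off a triple through the third, so all
      three must be nonempty. This is where \<open>t > 0\<close> enters.\<close>
    have ne: "S0 \<noteq> {}" "S1 \<noteq> {}" "S2 \<noteq> {}" using S0 S1 S2 t by auto
    have "contains_copy G (blow_up T3 t)"
      by (rule contains_blow_up_T3[OF G S0(1) S1(1) _ S0(2) S1(2) S2(2)]) (use S2(1) key ne in blast)+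
    with free show False ..
  qed
qed

subsection \<open>The weight bound\<close>

text \<open>The roles of source, middle and sink are forgotten, so that a given arc may occupy any
  position in the triangle.\<close>

definition spans :: "('a \<times> 'a) set \<Rightarrow> 'a \<Rightarrow> 'a \<Rightarrow> 'a \<Rightarrow> bool" where
  "spans E x y z \<longleftrightarrow> (x, y, z) \<in> tri E \<or> (x, z, y) \<in> tri E \<or> (y, x, z) \<in> tri E \<or>
     (y, z, x) \<in> tri E \<or> (z, x, y) \<in> tri E \<or> (z, y, x) \<in> tri E"

lemma spans_commute: "spans E x y z \<longleftrightarrow> spans E y x z"
  by (auto simp: spans_def)

lemma spans_mono:
  assumes "spans E x y z" "E \<subseteq> F"
  shows "spans F x y z"
proof -
  have "tri E \<subseteq> tri F" using assms(2) by (auto simp: tri_def)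
  then show ?thesis using assms(1) unfolding spans_def by blast
qed

lemma card_spans_le:
  assumes "finite (tri E)"
  shows "finite {(x, y, z). spans E x y z}" "card {(x, y, z). spans E x y z} \<le> 6 * card (tri E)"
proof -
  define perms :: "('a \<times> 'a \<times> 'a \<Rightarrow> 'a \<times> 'a \<times> 'a) list" where
    "perms = [id, \<lambda>(x, y, z). (x, z, y), \<lambda>(x, y, z). (y, x, z), \<lambda>(x, y, z). (y, z, x),
      \<lambda>(x, y, z). (z, x, y), \<lambda>(x, y, z). (z, y, x)]"
  have eq: "{(x, y, z). spans E x y z} = (\<Union>i<6. (perms ! i) ` tri E)"
    by (force simp: spans_def perms_def lessThan_nat_numeral lessThan_Suc numeral_eq_Suc image_iff)
  show "finite {(x, y, z). spans E x y z}" unfolding eq using assms by simp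
  have "card {(x, y, z). spans E x y z} \<le> (\<Sum>i<6::nat. card ((perms ! i) ` tri E))"
    unfolding eq by (rule card_UN_le) simp
  also have "\<dots> \<le> (\<Sum>i<6::nat. card (tri E))" by (intro sum_mono card_image_le assms)
  finally show "card {(x, y, z). spans E x y z} \<le> 6 * card (tri E)" by simp
qed

text \<open>Twice the critical weighting \<open>3/2 f\<^sub>2 + f\<^sub>1\<close>; summing over ordered pairs doubles it again.\<close>

definition wt :: "('a \<times> 'a) set \<Rightarrow> 'a \<Rightarrow> 'a \<Rightarrow> real" where
  "wt E u v = (if (u, v) \<in> E \<and> (v, u) \<in> E then 3 else if (u, v) \<in> E \<or> (v, u) \<in> E then 2 else 0)"

lemma wt_commute: "wt E u v = wt E v u"
  by (auto simp: wt_def)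

lemma sum_if_const:
  "finite W \<Longrightarrow> (\<Sum>z\<in>W. if P z then k else 0 :: real) = k * card {z \<in> W. P z}"
  by (simp flip: sum.inter_filter)

text \<open>Average over a small configuration in \<open>W\<close>. A vertex that forms no
  transitive triangle with two of its members sends total weight at most 3 to a double edge, 4 to a
  cyclic triangle if \<open>W\<close> has no double edge, and 2 to an arc if \<open>W\<close> has
  neither. Per member this never exceeds \<open>3 / 2\<close>.\<close>

lemma ex_low_weight_vertex:
  fixes c :: real
  assumes irr: "irrefl E" and V: "finite V" "W \<subseteq> V" "W \<noteq> {}" and c: "c \<ge> 0"
    and few: "\<And>u v. (u, v) \<in> E \<Longrightarrow> card {z \<in> V. spans E u v z} \<le> c"
  shows "\<exists>u\<in>W. (\<Sum>z\<in>W. wt E u z) \<le> 3 / 2 * card W + 2 * c"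
proof -
  have fin: "finite W" using V finite_subset by blast
  have few': "card {z \<in> W. spans E u v z} \<le> c" if "(u, v) \<in> E" for u v
  proof -
    have "card {z \<in> W. spans E u v z} \<le> card {z \<in> V. spans E u v z}"
      using V by (intro card_mono) auto
    then show ?thesis using few[OF that] by linarith
  qed
  let ?d = "\<lambda>u. \<Sum>z\<in>W. wt E u z"
  consider (double) u v where "u \<in> W" "v \<in> W" "(u, v) \<in> E" "(v, u) \<in> E"
    | (cyclic) x y z where "x \<in> W" "y \<in> W" "z \<in> W" "(x, y) \<in> E" "(y, z) \<in> E" "(z, x) \<in> E"
        "\<forall>u\<in>W. \<forall>v\<in>W. (u, v) \<in> E \<longrightarrow> (v, u) \<notin> E"
    | (arc) u v where "u \<in> W" "v \<in> W" "(u, v) \<in> E" "\<forall>u\<in>W. \<forall>v\<in>W. (u, v) \<in> E \<longrightarrow> (v, u) \<notin> E"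
        "\<forall>x\<in>W. \<forall>y\<in>W. \<forall>z\<in>W. \<not> ((x, y) \<in> E \<and> (y, z) \<in> E \<and> (z, x) \<in> E)"
    | (none) "\<forall>u\<in>W. \<forall>v\<in>W. (u, v) \<notin> E"
  proof -
    let ?D = "\<exists>u\<in>W. \<exists>v\<in>W. (u, v) \<in> E \<and> (v, u) \<in> E"
    let ?C = "\<exists>x\<in>W. \<exists>y\<in>W. \<exists>z\<in>W. (x, y) \<in> E \<and> (y, z) \<in> E \<and> (z, x) \<in> E"
    show ?thesis
    proof (cases ?D)
      case True
      then show ?thesis using that(1) by blast
    next
      case noD: False
      show ?thesis
      proof (cases ?C)
        case True
        then obtain x y z where "x \<in> W" "y \<in> W" "z \<in> W" "(x, y) \<in> E" "(y, z) \<in> E" "(z, x) \<in> E"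
          by blast
        from that(2)[OF this] noD show ?thesis by blast
      next
        case noC: False
        show ?thesis
        proof (cases "\<exists>u\<in>W. \<exists>v\<in>W. (u, v) \<in> E")
          case True
          then obtain u v where "u \<in> W" "v \<in> W" "(u, v) \<in> E" by blast
          from that(3)[OF this] noD noC show ?thesis by blast
        qed (use that(4) in blast)
      qed
    qed
  qed
  then show ?thesis
  proof cases
    case double
    \<comment> \<open>The arc between \<open>u\<close> and \<open>v\<close> is available in both
      directions, so a vertex joined to both spans a transitive triangle with them. Otherwise at
      most one of the two weights is nonzero.\<close>
    have "wt E u z + wt E v z \<le> 3 + (if spans E u v z then 3 else 0)" for z
      using double irr by (auto simp: wt_def spans_def tri_def irrefl_def)
    then have "(\<Sum>z\<in>W. wt E u z + wt E v z) \<le> (\<Sum>z\<in>W. 3 + (if spans E u v z then 3 else 0))"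
      by (intro sum_mono)
    then have "?d u + ?d v \<le> 3 * card W + 3 * card {z \<in> W. spans E u v z}"
      by (simp add: sum.distrib sum_if_const fin)
    then have "?d u + ?d v \<le> 3 * card W + 3 * c" using few'[OF double(3)] by linarith
    then have "?d u \<le> 3 / 2 * card W + 2 * c \<or> ?d v \<le> 3 / 2 * card W + 2 * c" using c by linarith
    then show ?thesis using double by blast
  next
    case cyclic
    have "wt E x w + wt E y w + wt E z w \<le> 4 + ((if spans E x y w then 2 else 0)
        + (if spans E y z w then 2 else 0) + (if spans E z x w then 2 else 0))" if "w \<in> W" for w
    proof -
      have "wt E u w = 0 \<or> wt E u w = 2" if "u \<in> W" for u
        using cyclic(7)[rule_format, OF that \<open>w \<in> W\<close>] by (auto simp: wt_def)
      \<comment> \<open>If \<open>w\<close> is joined to all three, two of these arcs both leave or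
        both enter \<open>w\<close>. Their other ends are joined by an arc, which completes a
        transitive triangle.\<close>
      moreover have "spans E x y w \<or> spans E y z w \<or> spans E z x w"
        if "wt E x w \<noteq> 0" "wt E y w \<noteq> 0" "wt E z w \<noteq> 0"
      proof -
        have "(x, w) \<in> E \<or> (w, x) \<in> E" "(y, w) \<in> E \<or> (w, y) \<in> E" "(z, w) \<in> E \<or> (w, z) \<in> E"
          using that by (auto simp: wt_def split: if_splits)
        then show ?thesis using cyclic(4-6) unfolding spans_def tri_def by auto
      qed
      ultimately show ?thesis using cyclic(1-3) by (smt (verit))
    qed
    then have "(\<Sum>w\<in>W. wt E x w + wt E y w + wt E z w) \<le> (\<Sum>w\<in>W. 4 + ((if spans E x y w then 2 else 0)
        + (if spans E y z w then 2 else 0) + (if spans E z x w then 2 else 0)))"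
      by (intro sum_mono)
    then have "?d x + ?d y + ?d z \<le> 4 * card W + (2 * card {w \<in> W. spans E x y w}
        + 2 * card {w \<in> W. spans E y z w} + 2 * card {w \<in> W. spans E z x w})"
      by (simp add: sum.distrib sum_if_const fin)
    \<comment> \<open>Three vertices share an error of \<open>6 * c\<close>; this case dictates the
      term \<open>2 * c\<close> in the bound.\<close>
    then have "?d x + ?d y + ?d z \<le> 4 * card W + 6 * c"
      using few'[OF cyclic(4)] few'[OF cyclic(5)] few'[OF cyclic(6)] by linarith
    then have "?d x \<le> 3 / 2 * card W + 2 * c \<or> ?d y \<le> 3 / 2 * card W + 2 * c
        \<or> ?d z \<le> 3 / 2 * card W + 2 * c" using c by linarith
    then show ?thesis using cyclic by blast
  next
    case arc
    have "wt E u z + wt E v z \<le> 2 + (if spans E u v z then 2 else 0)" if "z \<in> W" for z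
    proof -
      have "wt E x z = 0 \<or> wt E x z = 2" if "x \<in> W" for x
        using arc(4)[rule_format, OF that \<open>z \<in> W\<close>] by (auto simp: wt_def)
      moreover have "spans E u v z" if "wt E u z \<noteq> 0" "wt E v z \<noteq> 0"
      proof -
        have "(u, z) \<in> E \<or> (z, u) \<in> E" "(v, z) \<in> E \<or> (z, v) \<in> E"
          using that by (auto simp: wt_def split: if_splits)
        \<comment> \<open>The one orientation that would not be transitive closes a directed cycle,
          excluded in this case.\<close>
        moreover have "\<not> ((v, z) \<in> E \<and> (z, u) \<in> E)" using arc \<open>z \<in> W\<close> by blast
        ultimately show ?thesis using arc(3) unfolding spans_def tri_def by auto
      qed
      ultimately show ?thesis using arc(1,2) by (smt (verit))
    qed
    then have "(\<Sum>z\<in>W. wt E u z + wt E v z) \<le> (\<Sum>z\<in>W. 2 + (if spans E u v z then 2 else 0))"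
      by (intro sum_mono)
    then have "?d u + ?d v \<le> 2 * card W + 2 * card {z \<in> W. spans E u v z}"
      by (simp add: sum.distrib sum_if_const fin)
    then have "?d u + ?d v \<le> 2 * card W + 2 * c" using few'[OF arc(3)] by linarith
    then have "?d u \<le> 3 / 2 * card W + 2 * c \<or> ?d v \<le> 3 / 2 * card W + 2 * c" using c by linarith
    then show ?thesis using arc by blast
  next
    case none
    obtain u where "u \<in> W" using V by blast
    moreover have "?d u = 0" using none \<open>u \<in> W\<close> by (auto simp: wt_def intro!: sum.neutral)
    ultimately show ?thesis using c by (intro bexI[of _ u]) auto
  qed
qed

text \<open>Deleting a vertex of low weighted degree removes that degree twice, once per order of
  the pair, hence at most \<open>3 * card W + 4 * c\<close>; these losses sum to the bound. The
  triangle condition refers to the fixed set \<open>V\<close>, so it survives every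
  deletion.\<close>

lemma sum_wt_le:
  fixes c :: real
  assumes irr: "irrefl E" and V: "finite V" "W \<subseteq> V" and c: "c \<ge> 0"
    and few: "\<And>u v. (u, v) \<in> E \<Longrightarrow> card {z \<in> V. spans E u v z} \<le> c"
  shows "(\<Sum>u\<in>W. \<Sum>v\<in>W. wt E u v) \<le> 3 / 2 * (card W)\<^sup>2 + (4 * c + 3 / 2) * card W"
proof -
  have "finite W" using V finite_subset by blast
  then show ?thesis using V(2)
  proof (induction W rule: finite_psubset_induct)
    case (psubset W)
    show ?case
    proof (cases "W = {}")
      case False
      obtain u where u: "u \<in> W" and d: "(\<Sum>z\<in>W. wt E u z) \<le> 3 / 2 * card W + 2 * c"
        using ex_low_weight_vertex[OF irr V(1) psubset.prems False c few] by blast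
      let ?U = "W - {u}"
      have U: "card W = card ?U + 1" using card_Suc_Diff1[OF psubset.hyps u] by linarith
      have loop: "wt E u u = 0" using irr by (auto simp: wt_def irrefl_def)
      have split: "(\<Sum>z\<in>W. f z) = f u + (\<Sum>z\<in>?U. f z)" for f :: "'a \<Rightarrow> real"
        by (rule sum.remove[OF psubset.hyps u])
      have "(\<Sum>u\<in>W. \<Sum>v\<in>W. wt E u v) = (\<Sum>z\<in>W. wt E u z) + (\<Sum>z\<in>?U. \<Sum>v\<in>W. wt E z v)"
        by (rule split)
      also have "(\<Sum>z\<in>?U. \<Sum>v\<in>W. wt E z v) = (\<Sum>z\<in>?U. wt E u z) + (\<Sum>z\<in>?U. \<Sum>v\<in>?U. wt E z v)"
        by (simp only: split sum.distrib) (simp only: wt_commute)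
      also have "(\<Sum>z\<in>?U. wt E u z) = (\<Sum>z\<in>W. wt E u z)" using loop by (simp add: split)
      finally have eq: "(\<Sum>u\<in>W. \<Sum>v\<in>W. wt E u v) =
          (\<Sum>z\<in>W. wt E u z) + ((\<Sum>z\<in>W. wt E u z) + (\<Sum>z\<in>?U. \<Sum>v\<in>?U. wt E z v))" .
      have IH: "(\<Sum>z\<in>?U. \<Sum>v\<in>?U. wt E z v) \<le> 3 / 2 * (card ?U)\<^sup>2 + (4 * c + 3 / 2) * card ?U"
        using u psubset.prems by (intro psubset.IH) auto
      have "(\<Sum>u\<in>W. \<Sum>v\<in>W. wt E u v) \<le> (3 / 2 * card W + 2 * c) +
          ((3 / 2 * card W + 2 * c) + (3 / 2 * (card ?U)\<^sup>2 + (4 * c + 3 / 2) * card ?U))"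
        unfolding eq by (intro add_mono d IH)
      also have "\<dots> = 3 / 2 * (card W)\<^sup>2 + (4 * c + 3 / 2) * card W"
        by (simp add: U power2_eq_square algebra_simps)
      finally show ?thesis .
    qed simp
  qed
qed

section \<open>Conversion between sums over ordered pairs and edge counts\<close>

lemma sum_wt_eq:
  assumes "finite V" "E \<subseteq> V \<times> V"
  shows "(\<Sum>u\<in>V. \<Sum>v\<in>V. wt E u v) = 3 * card (E \<inter> E\<inverse>) + 2 * card (E \<union> E\<inverse> - E \<inter> E\<inverse>)"
proof -
  let ?D = "E \<inter> E\<inverse>" and ?S = "E \<union> E\<inverse> - E \<inter> E\<inverse>"
  have "(\<Sum>u\<in>V. \<Sum>v\<in>V. wt E u v) = (\<Sum>p\<in>V \<times> V. (if p \<in> ?D then 3 else 0) + (if p \<in> ?S then 2 else 0))"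
    by (auto simp: sum.cartesian_product wt_def intro!: sum.cong)
  also have "\<dots> = 3 * card {p \<in> V \<times> V. p \<in> ?D} + 2 * card {p \<in> V \<times> V. p \<in> ?S}"
    unfolding sum.distrib using assms(1) by (subst (1 2) sum_if_const) auto
  also have "{p \<in> V \<times> V. p \<in> ?D} = ?D" using assms(2) by auto
  also have "{p \<in> V \<times> V. p \<in> ?S} = ?S" using assms(2) by auto
  finally show ?thesis .
qed

text \<open>Each unordered pair has two distinct orientations in \<open>R\<close>. This links
  \<open>f1\<close> and \<open>f2\<close>, defined by unordered pairs, to cardinalities of arc
  sets.\<close>

lemma card_sym_eq_twice_card_pairs:
  assumes "finite R" "sym R" "irrefl R"
  shows "card R = 2 * card {{u, v} | u v. (u, v) \<in> R}"
proof -
  let ?g = "\<lambda>(u, v). {u, v}"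
  have img: "?g ` R = {{u, v} | u v. (u, v) \<in> R}" by force
  have "card R = (\<Sum>e\<in>?g ` R. card {p \<in> R. ?g p = e})"
    using sum.image_gen[OF assms(1), of "\<lambda>_. 1::nat" ?g] by simp
  also have "\<dots> = (\<Sum>e\<in>?g ` R. 2)"
  proof (rule sum.cong[OF refl])
    fix e assume "e \<in> ?g ` R"
    then obtain u v where uv: "(u, v) \<in> R" "e = {u, v}" by auto
    then have "{p \<in> R. ?g p = e} = {(u, v), (v, u)}" "u \<noteq> v"
      using assms(2,3) by (auto simp: doubleton_eq_iff sym_def irrefl_def)
    then show "card {p \<in> R. ?g p = e} = 2" by simp
  qed
  finally show ?thesis by (simp add: img)
qed

subsection \<open>Stability\<close>

text \<open>Take \<open>A\<close> as the neighbourhood of a vertex \<open>x\<close> of maximum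
  degree. A vertex of \<open>A\<close> has at most \<open>c\<close> neighbours in \<open>A\<close>,
  as these are common neighbours with \<open>x\<close>; a vertex outside \<open>A\<close> has degree
  at most \<open>card A\<close>.\<close>

lemma Furedi_stability:
  fixes c :: real
  assumes V: "finite V" "V \<noteq> {}" "F \<subseteq> V \<times> V" and sym: "sym F" and c: "c \<ge> 0"
    and few: "\<And>u v. (u, v) \<in> F \<Longrightarrow> card {w. (u, w) \<in> F \<and> (v, w) \<in> F} \<le> c"
  obtains A where "A \<subseteq> V" "card (F \<inter> A \<times> A) \<le> c * card V"
    "card F + card (F \<inter> (V - A) \<times> (V - A)) \<le> c * card V + 2 * card A * card (V - A)"
proof -
  let ?N = "\<lambda>v. {w. (v, w) \<in> F}"
  have finF: "finite F" using V by (meson finite_SigmaI finite_subset)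
  have "finite ((\<lambda>v. card (?N v)) ` V)" using V by simp
  then obtain x where x: "x \<in> V" and xmax: "\<And>v. v \<in> V \<Longrightarrow> card (?N v) \<le> card (?N x)"
    using V Max_in[of "(\<lambda>v. card (?N v)) ` V"] Max_ge[of "(\<lambda>v. card (?N v)) ` V"]
    by (smt (verit, del_insts) image_iff image_is_empty)
  define A where "A = ?N x"
  define B where "B = V - A"
  have AV: "A \<subseteq> V" using V by (auto simp: A_def)
  have finA: "finite A" "finite B" using V AV finite_subset by (auto simp: B_def)
  have finN: "finite (?N v)" for v using V by (rule_tac finite_subset[of _ V]) auto
  have "F \<inter> A \<times> A = Sigma A (\<lambda>y. {w \<in> A. (y, w) \<in> F})" by auto
  then have "real (card (F \<inter> A \<times> A)) = (\<Sum>y\<in>A. real (card {w \<in> A. (y, w) \<in> F}))"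
    using finA by simp
  also have "\<dots> \<le> (\<Sum>y\<in>A. c)"
    using few by (intro sum_mono) (auto simp: A_def)
  also have "\<dots> \<le> c * card V"
    using c card_mono[OF V(1) AV] by (simp add: mult.commute mult_left_mono)
  finally have AA: "card (F \<inter> A \<times> A) \<le> c * card V" .
  have "F \<inter> B \<times> V = Sigma B ?N" using V by auto
  then have "card (F \<inter> B \<times> V) = (\<Sum>y\<in>B. card (?N y))" using finA finN by simp
  also have "\<dots> \<le> (\<Sum>y\<in>B. card A)" using xmax by (intro sum_mono) (auto simp: A_def B_def)
  finally have BV: "card (F \<inter> B \<times> V) \<le> card A * card B" by (simp add: mult.commute)
  have "F \<inter> A \<times> B = (F \<inter> B \<times> A)\<inverse>" using sym by (auto simp: sym_def)
  then have AB: "card (F \<inter> A \<times> B) = card (F \<inter> B \<times> A)" by (simp add: card_inverse)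
  have split: "card (F \<inter> X \<times> V) = card (F \<inter> X \<times> A) + card (F \<inter> X \<times> B)" for X
  proof -
    have "F \<inter> X \<times> V = (F \<inter> X \<times> A) \<union> (F \<inter> X \<times> B)" using AV by (auto simp: B_def)
    then show ?thesis using finF by (auto simp: B_def intro: card_Un_disjoint)
  qed
  have "F = (F \<inter> A \<times> V) \<union> (F \<inter> B \<times> V)" using V by (auto simp: B_def)
  moreover have "(F \<inter> A \<times> V) \<inter> (F \<inter> B \<times> V) = {}" by (auto simp: B_def)
  ultimately have "card F = card (F \<inter> A \<times> V) + card (F \<inter> B \<times> V)"
    using finF by (metis card_Un_disjoint finite_Int)
  \<comment> \<open>By symmetry the left side equals the arcs inside \<open>A\<close> plus twice the
    arcs starting in \<open>B\<close>.\<close>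
  then have "card F + card (F \<inter> B \<times> B) \<le> card (F \<inter> A \<times> A) + 2 * (card A * card B)"
    using BV by (simp add: split AB)
  then have "card F + card (F \<inter> B \<times> B) \<le> card (F \<inter> A \<times> A) + 2 * (real (card A) * card B)"
    by (metis (mono_tags) of_nat_add of_nat_le_iff of_nat_mult of_nat_numeral)
  then have "card F + card (F \<inter> B \<times> B) \<le> c * card V + 2 * card A * card B"
    using AA by simp
  then show thesis using that[OF AV] AA by (auto simp: B_def)
qed

section \<open>Balanced bipartitions and the distance to them\<close>

definition bip :: "'a set \<Rightarrow> 'a set \<Rightarrow> ('a \<times> 'a) set" where
  "bip A B = A \<times> B \<union> B \<times> A"

text \<open>Either remove surplus vertices from \<open>A\<close> or add missing ones; the 1 absorbs
  the rounding for odd \<open>card V\<close>.\<close>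

lemma ex_subset_card_half_near:
  assumes "finite V" "A \<subseteq> V"
  obtains A' where "A' \<subseteq> V" "card A' = card V div 2"
    "real (card (A - A' \<union> (A' - A))) \<le> \<bar>real (card A) - card V / 2\<bar> + 1"
proof -
  let ?h = "card V div 2"
  have finA: "finite A" using assms finite_subset by blast
  have h: "real ?h \<le> card V / 2" "card V / 2 \<le> real ?h + 1"
    by linarith+
  show thesis
  proof (cases "?h \<le> card A")
    case True
    then obtain A' where A': "A' \<subseteq> A" "card A' = ?h" by (meson obtain_subset_with_card_n)
    then have "A - A' \<union> (A' - A) = A - A'" by auto
    moreover have "card (A - A') = card A - ?h"
      using A' finA by (simp add: card_Diff_subset finite_subset)
    ultimately show thesis using that[of A'] A' assms True h by (auto simp: of_nat_diff)
  next
    case False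
    have "card (V - A) = card V - card A" using assms finA by (simp add: card_Diff_subset)
    then have "?h - card A \<le> card (V - A)" by linarith
    then obtain C where C: "C \<subseteq> V - A" "card C = ?h - card A" by (meson obtain_subset_with_card_n)
    have finC: "finite C" using C assms finite_subset by blast
    have "card (A \<union> C) = card A + card C" using C finA finC by (intro card_Un_disjoint) auto
    moreover have "A - (A \<union> C) \<union> (A \<union> C - A) = C" using C by auto
    ultimately show thesis using that[of "A \<union> C"] C assms False h by (auto simp: of_nat_diff)
  qed
qed

text \<open>Near-maximality of \<open>card F\<close> leaves little slack in
  \<open>Furedi_stability\<close>: few arcs lie inside the second part too, and the parts have
  nearly equal size. Moving about \<open>sqrt \<tau> * card V\<close> vertices then balances them at
  a cost of at most \<open>2 * card V\<close> ordered pairs per vertex.\<close>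

lemma near_balanced_bipartition:
  fixes \<tau> :: real
  assumes V: "finite V" "V \<noteq> {}" "F \<subseteq> V \<times> V" and sym: "sym F" and \<tau>: "\<tau> \<ge> 0"
    and few: "\<And>u v. (u, v) \<in> F \<Longrightarrow> card {w. (u, w) \<in> F \<and> (v, w) \<in> F} \<le> \<tau> * card V"
    and many: "card F \<ge> (1 / 2 - \<tau>) * (card V)\<^sup>2"
  obtains A where "A \<subseteq> V" "card A = card V div 2"
    "card (F - bip A (V - A)) \<le> (3 * \<tau> + 2 * sqrt \<tau>) * (card V)\<^sup>2 + 2 * card V"
    "card (bip A (V - A) - F) \<le> (4 * \<tau> + 2 * sqrt \<tau>) * (card V)\<^sup>2 + 2 * card V"
proof -
  define n where "n = real (card V)"
  have finF: "finite F" using V by (meson finite_SigmaI finite_subset)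
  obtain A where A: "A \<subseteq> V" "card (F \<inter> A \<times> A) \<le> \<tau> * card V * card V"
    "card F + card (F \<inter> (V - A) \<times> (V - A)) \<le> \<tau> * card V * card V + 2 * card A * card (V - A)"
    using Furedi_stability[OF V sym _ few] \<tau> by (metis mult_nonneg_nonneg of_nat_0_le_iff)
  define x where "x = real (card A)"
  have finA: "finite A" using A V finite_subset by blast
  have cB: "real (card (V - A)) = n - x"
    using A(1) V(1) finA by (simp add: card_Diff_subset n_def x_def of_nat_diff card_mono)
  have AA: "card (F \<inter> A \<times> A) \<le> \<tau> * n\<^sup>2" using A(2) by (simp add: n_def power2_eq_square)
  have FB: "card F + card (F \<inter> (V - A) \<times> (V - A)) \<le> \<tau> * n\<^sup>2 + 2 * x * (n - x)"
    using A(3) unfolding cB[symmetric] by (simp add: n_def x_def power2_eq_square)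
  have F: "card F \<ge> n\<^sup>2 / 2 - \<tau> * n\<^sup>2" using many by (simp add: n_def left_diff_distrib)
  \<comment> \<open>The square measures the imbalance; both it and the arcs inside the second part
    must fit into the slack of \<open>2 * \<tau> * n\<^sup>2\<close>.\<close>
  have sq: "2 * x * (n - x) = n\<^sup>2 / 2 - 2 * (x - n / 2)\<^sup>2"
    by (simp add: power2_eq_square field_simps)
  have BB: "card (F \<inter> (V - A) \<times> (V - A)) \<le> 2 * \<tau> * n\<^sup>2"
    using FB F sq zero_le_power2[of "x - n / 2"] by linarith
  have "(x - n / 2)\<^sup>2 \<le> \<tau> * n\<^sup>2"
    using FB F sq by linarith
  also have "\<dots> = (sqrt \<tau> * n)\<^sup>2" using \<tau> by (simp add: power_mult_distrib)
  finally have dev: "\<bar>x - n / 2\<bar> \<le> sqrt \<tau> * n"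
    using \<tau> by (simp add: abs_le_square_iff[symmetric] n_def)
  obtain A' where A': "A' \<subseteq> V" "card A' = card V div 2"
    and M: "real (card (A - A' \<union> (A' - A))) \<le> \<bar>x - n / 2\<bar> + 1"
    using ex_subset_card_half_near[OF V(1) A(1)] unfolding x_def n_def by blast
  let ?M = "A - A' \<union> (A' - A)" and ?K = "bip A' (V - A')"
  have finM: "finite ?M" using A A' V finite_subset by blast
  \<comment> \<open>An arc inside a new part either lies inside an old part or touches a moved
    vertex.\<close>
  have "F - ?K \<subseteq> (F \<inter> A \<times> A) \<union> (F \<inter> (V - A) \<times> (V - A)) \<union> (?M \<times> V \<union> V \<times> ?M)"
    using V(3) by (auto simp: bip_def)
  then have "card (F - ?K) \<le> card ((F \<inter> A \<times> A) \<union> (F \<inter> (V - A) \<times> (V - A)) \<union> (?M \<times> V \<union> V \<times> ?M))"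
    using finF finM V by (intro card_mono) auto
  also have "\<dots> \<le> card (F \<inter> A \<times> A) + card (F \<inter> (V - A) \<times> (V - A)) + (card (?M \<times> V) + card (V \<times> ?M))"
    by (meson add_mono card_Un_le order_trans)
  finally have "card (F - ?K) \<le> card (F \<inter> A \<times> A) + card (F \<inter> (V - A) \<times> (V - A)) + 2 * (card ?M * card V)"
    by (simp add: card_cartesian_product mult.commute)
  then have "real (card (F - ?K)) \<le> card (F \<inter> A \<times> A) + card (F \<inter> (V - A) \<times> (V - A)) + 2 * (card ?M * n)"
    unfolding n_def by (metis (mono_tags) of_nat_add of_nat_le_iff of_nat_mult of_nat_numeral)
  moreover have "card ?M * n \<le> (sqrt \<tau> * n + 1) * n"
    using M dev by (intro mult_right_mono) (auto simp: n_def)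
  ultimately have FK: "card (F - ?K) \<le> (3 * \<tau> + 2 * sqrt \<tau>) * n\<^sup>2 + 2 * n"
    using AA BB by (simp add: algebra_simps power2_eq_square)
  have finK: "finite ?K" using V A' by (auto simp: bip_def intro: finite_subset)
  have "card ?K \<le> card (A' \<times> (V - A')) + card ((V - A') \<times> A')"
    unfolding bip_def by (rule card_Un_le)
  also have "\<dots> = 2 * (card A' * card (V - A'))" by (simp add: card_cartesian_product)
  finally have "real (card ?K) \<le> 2 * (real (card A') * card (V - A'))"
    by (metis (mono_tags) of_nat_le_iff of_nat_mult of_nat_numeral)
  also have "real (card (V - A')) = n - card A'"
    using A' V finite_subset[OF A'(1) V(1)] by (simp add: card_Diff_subset n_def of_nat_diff card_mono)
  also have "2 * (card A' * (n - card A')) = n\<^sup>2 / 2 - 2 * (card A' - n / 2)\<^sup>2"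
    by (simp add: power2_eq_square field_simps)
  finally have "card ?K \<le> n\<^sup>2 / 2" using zero_le_power2[of "card A' - n / 2"] by linarith
  \<comment> \<open>Comparing sizes through the common part turns the bound on surplus arcs into one
    on missing arcs.\<close>
  moreover have "card ?K = card (?K \<inter> F) + card (?K - F)" "card F = card (?K \<inter> F) + card (F - ?K)"
    using card_Int_Diff[OF finK, of F] card_Int_Diff[OF finF, of ?K] by (simp_all add: Int_commute)
  ultimately have "card (?K - F) \<le> n\<^sup>2 / 2 - card F + card (F - ?K)" by linarith
  then have "card (?K - F) \<le> (4 * \<tau> + 2 * sqrt \<tau>) * n\<^sup>2 + 2 * n"
    using FK F by (simp add: algebra_simps)
  then show thesis using that[OF A'] FK by (simp add: n_def)
qed

text \<open>After deleting the pairs in many triangles, the bound for the critical weighting is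
  compared with the assumed weight. The gap \<open>a - 3 / 2\<close> forces nearly all weight onto
  double edges, whose graph has small codegrees and is therefore nearly balanced bipartite.\<close>

lemma near_bipartite_if_few_triangles:
  fixes a \<tau> :: real
  assumes V: "finite V" "V \<noteq> {}" "E \<subseteq> V \<times> V" and irr: "irrefl E"
    and a: "3 / 2 < a" "a \<le> 2" and \<tau>: "\<tau> > 0" "1 \<le> \<tau> * card V"
    and \<sigma>: "\<sigma> = 8 * \<tau> / (a - 3 / 2)" "\<sigma> \<le> 1"
    and few: "card (tri E) \<le> \<tau>\<^sup>2 / 6 * card V ^ 3"
    and weight: "a * card (E \<inter> E\<inverse>) + card (E \<union> E\<inverse> - E \<inter> E\<inverse>) \<ge> (a / 2 - 2 * \<tau>) * (card V)\<^sup>2"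
  obtains A where "A \<subseteq> V" "card A = card V div 2"
    "card ((E - bip A (V - A)) \<union> (bip A (V - A) - E)) \<le> 15 * sqrt \<sigma> * (card V)\<^sup>2"
proof -
  define n where "n = real (card V)"
  define \<kappa> where "\<kappa> = a - 3 / 2"
  have \<kappa>: "\<kappa> > 0" "\<kappa> \<le> 1 / 2" "\<sigma> * \<kappa> = 8 * \<tau>" using a \<sigma> by (auto simp: \<kappa>_def)
  have "16 * \<tau> * \<kappa> \<le> 16 * \<tau> * (1 / 2)" using \<kappa>(2) \<tau>(1) by (intro mult_left_mono) auto
  then have "16 * \<tau> * \<kappa> \<le> \<sigma> * \<kappa>" using \<kappa>(3) by simp
  then have \<tau>\<sigma>: "16 * \<tau> \<le> \<sigma>" using \<kappa>(1) by simp
  have n: "n > 0" "1 \<le> \<tau> * n" using V \<tau> by (auto simp: n_def card_gt_0_iff)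
  have finE: "finite E" using V by (meson finite_SigmaI finite_subset)
  have fint: "finite (tri E)"
    by (rule finite_subset[of _ "V \<times> V \<times> V"]) (use V in \<open>auto simp: tri_def\<close>)
  define P where "P = {(u, v) \<in> V \<times> V. \<tau> * n < card {z \<in> V. spans E u v z}}"
  have finP: "finite P" using V by (auto simp: P_def intro: finite_subset[of _ "V \<times> V"])
  \<comment> \<open>Symmetry ensures that deleting \<open>P\<close> removes both directions of a
    pair, so no double edge is turned into a single arc.\<close>
  have Psym: "(v, u) \<in> P" if "(u, v) \<in> P" for u v
    using that spans_commute[of E u v] by (auto simp: P_def)
  \<comment> \<open>Each pair in \<open>P\<close> accounts for more than \<open>\<tau> * n\<close>
    spanning triples, of which there are at most \<open>\<tau>\<^sup>2 * n ^ 3\<close>; hence the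
    factor \<open>\<tau>\<^sup>2 / 6\<close> in the hypothesis.\<close>
  have "\<tau> * n * card P = (\<Sum>p\<in>P. \<tau> * n)" by simp
  also have "\<dots> \<le> (\<Sum>p\<in>P. real (card {z \<in> V. spans E (fst p) (snd p) z}))"
    by (intro sum_mono) (auto simp: P_def)
  also have "\<dots> = card (Sigma P (\<lambda>p. {z \<in> V. spans E (fst p) (snd p) z}))"
    using finP V by simp
  also have "\<dots> = card ((\<lambda>((x, y), z). (x, y, z)) ` Sigma P (\<lambda>p. {z \<in> V. spans E (fst p) (snd p) z}))"
    by (subst card_image) (auto simp: inj_on_def)
  also have "\<dots> \<le> card {(x, y, z). spans E x y z}"
    using card_spans_le(1)[OF fint] by (intro of_nat_mono card_mono) auto
  also have "\<dots> \<le> 6 * card (tri E)" using card_spans_le(2)[OF fint] by (intro of_nat_mono)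
  also have "\<dots> \<le> \<tau> * n * (\<tau> * n\<^sup>2)"
    using few by (simp add: n_def power2_eq_square power3_eq_cube mult_ac)
  finally have P: "card P \<le> \<tau> * n\<^sup>2" using n \<tau> by (simp add: mult_le_cancel_left_pos)
  define E' where "E' = E - P"
  have E': "E' \<subseteq> E" "E' \<subseteq> V \<times> V" "irrefl E'" using V irr by (auto simp: E'_def irrefl_def)
  have few': "card {z \<in> V. spans E u v z} \<le> \<tau> * n" if "(u, v) \<in> E'" for u v
    using that V by (auto simp: E'_def P_def not_less)
  have few'': "card {z \<in> V. spans E' u v z} \<le> \<tau> * n" if "(u, v) \<in> E'" for u v
  proof -
    have "card {z \<in> V. spans E' u v z} \<le> card {z \<in> V. spans E u v z}"
      using V spans_mono[OF _ E'(1)] by (intro card_mono) auto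
    then show ?thesis using few'[OF that] by linarith
  qed
  let ?D = "E \<inter> E\<inverse>" and ?S = "E \<union> E\<inverse> - E \<inter> E\<inverse>"
  let ?F = "E' \<inter> E'\<inverse>" and ?S' = "E' \<union> E'\<inverse> - E' \<inter> E'\<inverse>"
  have fin: "finite ?D" "finite ?S" "finite ?F" "finite ?S'"
    using finE by (auto simp: E'_def)
  have DF: "?D \<subseteq> ?F \<union> P" "?S \<subseteq> ?S' \<union> P" "E - ?F \<subseteq> P \<union> ?S'"
    using Psym by (auto simp: E'_def)
  have "card ?D \<le> card ?F + card P" "card ?S \<le> card ?S' + card P" "card (E - ?F) \<le> card P + card ?S'"
    using card_mono[OF _ DF(1)] card_mono[OF _ DF(2)] card_mono[OF _ DF(3)] fin finP
      card_Un_le[of ?F P] card_Un_le[of ?S' P] card_Un_le[of P ?S'] by (auto intro: order_trans)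
  then have le: "card ?D \<le> card ?F + \<tau> * n\<^sup>2" "card ?S \<le> card ?S' + \<tau> * n\<^sup>2"
      "card (E - ?F) \<le> \<tau> * n\<^sup>2 + card ?S'"
    using P by linarith+
  have weight': "(a / 2 - 2 * \<tau>) * n\<^sup>2 \<le> a * card ?D + card ?S"
    using weight by (simp add: n_def)
  have "a * card ?D \<le> a * (card ?F + \<tau> * n\<^sup>2)" using le(1) a by (intro mult_left_mono) auto
  also have "\<dots> \<le> a * card ?F + 2 * (\<tau> * n\<^sup>2)"
    using a \<tau> by (simp add: distrib_left mult_right_mono)
  finally have "(a / 2 - 2 * \<tau>) * n\<^sup>2 \<le> a * card ?F + card ?S' + 3 * (\<tau> * n\<^sup>2)"
    using le(2) weight' by linarith
  then have lower: "(a / 2) * n\<^sup>2 - 5 * (\<tau> * n\<^sup>2) \<le> a * card ?F + card ?S'"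
    by (simp add: algebra_simps)
  have "3 * card ?F + 2 * card ?S' \<le> 3 / 2 * n\<^sup>2 + (4 * (\<tau> * n) + 3 / 2) * n"
    using sum_wt_le[OF E'(3) V(1) order.refl _ few''] sum_wt_eq[OF V(1) E'(2)] \<tau> n
    by (simp add: n_def)
  \<comment> \<open>The hypothesis \<open>1 \<le> \<tau> * card V\<close> absorbs the linear
    term.\<close>
  also have "\<dots> \<le> 3 / 2 * n\<^sup>2 + (6 * (\<tau> * n)) * n"
    using n by (intro add_left_mono mult_right_mono) auto
  finally have upper: "3 * card ?F + 2 * card ?S' \<le> 3 / 2 * n\<^sup>2 + 6 * (\<tau> * n\<^sup>2)"
    by (simp add: power2_eq_square algebra_simps)
  \<comment> \<open>Subtracting half of \<open>upper\<close> from \<open>lower\<close> cancels the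
    single arcs. The errors 5 and 3 add up to the 8 in the definition of
    \<open>\<sigma>\<close>.\<close>
  have "\<kappa> * (n\<^sup>2 / 2) - 8 * \<tau> * n\<^sup>2 \<le> \<kappa> * card ?F"
  proof -
    have "\<kappa> * (n\<^sup>2 / 2) = a / 2 * n\<^sup>2 - 3 / 4 * n\<^sup>2" "\<kappa> * card ?F = a * card ?F - 3 / 2 * card ?F"
      by (simp_all add: \<kappa>_def field_simps)
    then show ?thesis using lower upper by linarith
  qed
  then have "\<kappa> * ((1 / 2 - \<sigma>) * n\<^sup>2) \<le> \<kappa> * card ?F"
    unfolding \<kappa>(3)[symmetric] by (simp add: algebra_simps)
  then have F: "(1 / 2 - \<sigma>) * n\<^sup>2 \<le> card ?F" using \<kappa>(1) by simp
  have \<tau>\<sigma>n: "16 * (\<tau> * n\<^sup>2) \<le> \<sigma> * n\<^sup>2"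
    using mult_right_mono[OF \<tau>\<sigma>, of "n\<^sup>2"] by simp
  have "card ?S' \<le> 3 / 2 * (\<sigma> * n\<^sup>2) + 3 * (\<tau> * n\<^sup>2)"
    using F upper by (simp add: algebra_simps)
  then have EF: "card (E - ?F) \<le> 2 * (\<sigma> * n\<^sup>2)" using le(3) \<tau>\<sigma>n by linarith
  have \<sigma>0: "\<sigma> \<ge> 0" using \<tau>\<sigma> \<tau> by linarith
  \<comment> \<open>A common neighbour of the ends of a double edge spans a transitive triangle with
    them.\<close>
  have codeg: "card {w. (u, w) \<in> ?F \<and> (v, w) \<in> ?F} \<le> \<sigma> * card V" if "(u, v) \<in> ?F" for u v
  proof -
    have "card {w. (u, w) \<in> ?F \<and> (v, w) \<in> ?F} \<le> card {z \<in> V. spans E u v z}"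
    proof (intro card_mono)
      show "{w. (u, w) \<in> ?F \<and> (v, w) \<in> ?F} \<subseteq> {z \<in> V. spans E u v z}"
        using that E'(1,2) unfolding spans_def tri_def by blast
    qed (use V in simp)
    moreover have "\<tau> * n \<le> \<sigma> * n" using \<tau>\<sigma> \<tau> n by (intro mult_right_mono) auto
    ultimately show ?thesis using few'[of u v] that unfolding n_def by auto
  qed
  have F': "(1 / 2 - \<sigma>) * (card V)\<^sup>2 \<le> card ?F" using F by (simp add: n_def)
  have symF: "sym ?F" by (auto simp: sym_def)
  have FV: "?F \<subseteq> V \<times> V" using E' by auto
  obtain A where A: "A \<subseteq> V" "card A = card V div 2"
    and FK: "card (?F - bip A (V - A)) \<le> (3 * \<sigma> + 2 * sqrt \<sigma>) * (card V)\<^sup>2 + 2 * card V"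
    and KF: "card (bip A (V - A) - ?F) \<le> (4 * \<sigma> + 2 * sqrt \<sigma>) * (card V)\<^sup>2 + 2 * card V"
    using near_balanced_bipartition[OF V(1,2) FV symF \<sigma>0 codeg F'] by blast
  let ?K = "bip A (V - A)"
  have finK: "finite ?K" using V A by (auto simp: bip_def intro: finite_subset)
  \<comment> \<open>Triangle inequality for symmetric differences, through the double edges
    \<open>?F\<close>.\<close>
  have "(E - ?K) \<union> (?K - E) \<subseteq> (E - ?F) \<union> (?F - ?K) \<union> (?K - ?F)" using E' by auto
  then have "card ((E - ?K) \<union> (?K - E)) \<le> card ((E - ?F) \<union> (?F - ?K) \<union> (?K - ?F))"
    using finE fin finK by (intro card_mono) auto
  also have "\<dots> \<le> card (E - ?F) + card (?F - ?K) + card (?K - ?F)"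
    by (meson add_mono card_Un_le order_trans order.refl)
  finally have "card ((E - ?K) \<union> (?K - E)) \<le> card (E - ?F) + real (card (?F - ?K)) + card (?K - ?F)"
    by linarith
  also have "\<dots> \<le> 9 * (\<sigma> * n\<^sup>2) + 4 * (sqrt \<sigma> * n\<^sup>2) + 4 * n"
    using EF FK KF unfolding n_def by (simp add: algebra_simps)
  also have "\<dots> \<le> 10 * (\<sigma> * n\<^sup>2) + 4 * (sqrt \<sigma> * n\<^sup>2)"
  proof -
    have "n \<le> \<tau> * n\<^sup>2" using mult_right_mono[OF n(2), of n] n(1) by (simp add: power2_eq_square)
    then show ?thesis using \<tau>\<sigma>n n(1) by linarith
  qed
  also have "\<dots> \<le> 15 * (sqrt \<sigma> * n\<^sup>2)"
  proof -
    have "sqrt \<sigma> * sqrt \<sigma> \<le> sqrt \<sigma> * 1" using \<sigma>0 \<sigma>(2) by (intro mult_left_mono) auto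
    then have "\<sigma> * n\<^sup>2 \<le> sqrt \<sigma> * n\<^sup>2" using \<sigma>0 by (intro mult_right_mono) auto
    moreover have "0 \<le> sqrt \<sigma> * n\<^sup>2" using \<sigma>0 by simp
    ultimately show ?thesis by linarith
  qed
  finally show thesis using that[OF A] by (simp add: n_def)
qed

section \<open>Choice of constants and translation to \<open>f1\<close>, \<open>f2\<close> and
  \<open>near_DTu2\<close>\<close>

theorem theorem4p1:
  fixes a :: real and t :: nat
  assumes "3 / 2 < a" and "a \<le> 2" and "t > 0"
  shows "\<forall>\<beta>::real. \<beta> > 0 \<longrightarrow> (\<exists>\<gamma>::real. \<gamma> > 0 \<and> (\<exists>n0::nat.
    \<forall>(G :: 'a pair_pre_digraph) (n::nat).
      pair_digraph G \<and> card (pverts G) = n \<and> n \<ge> n0 \<and>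
      \<not> contains_copy G (blow_up T3 t) \<and>
      \<bar>e_weight a G - a * (1 / 2) * ((real n)\<^sup>2 / 2)\<bar> \<le> \<gamma> * (real n)\<^sup>2
      \<longrightarrow> near_DTu2 G (\<beta> * (real n)\<^sup>2)))"
proof (intro allI impI)
  fix \<beta> :: real assume \<beta>: "\<beta> > 0"
  \<comment> \<open>Chosen so that \<open>15 * sqrt \<sigma> \<le> \<beta>\<close>; then
    \<open>\<tau>\<close> is found by solving for it in the relation between \<open>\<sigma>\<close>
    and \<open>\<tau>\<close>, and it also serves as \<open>\<gamma>\<close>.\<close>
  define \<sigma> where "\<sigma> = min 1 ((\<beta> / 15)\<^sup>2)"
  have \<sigma>: "\<sigma> > 0" "\<sigma> \<le> 1" "sqrt \<sigma> \<le> \<beta> / 15"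
    using \<beta> real_sqrt_le_mono[of \<sigma> "(\<beta> / 15)\<^sup>2"] by (simp_all add: \<sigma>_def)
  define \<tau> where "\<tau> = \<sigma> * (a - 3 / 2) / 8"
  have \<tau>: "\<tau> > 0" "\<sigma> = 8 * \<tau> / (a - 3 / 2)" using \<sigma> assms by (auto simp: \<tau>_def)
  obtain n1 where n1: "\<And>G :: 'a pair_pre_digraph. \<lbrakk>pair_digraph G; card (pverts G) \<ge> n1;
      \<not> contains_copy G (blow_up T3 t)\<rbrakk> \<Longrightarrow> card (tri (parcs G)) \<le> \<tau>\<^sup>2 / 6 * card (pverts G) ^ 3"
    using few_transitive_triangles[of "\<tau>\<^sup>2 / 6" t] \<tau> assms(3) by auto
  define n0 where "n0 = n1 + nat \<lceil>1 / \<tau>\<rceil> + 1"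
  show "\<exists>\<gamma>::real. \<gamma> > 0 \<and> (\<exists>n0::nat. \<forall>(G :: 'a pair_pre_digraph) (n::nat).
      pair_digraph G \<and> card (pverts G) = n \<and> n \<ge> n0 \<and> \<not> contains_copy G (blow_up T3 t) \<and>
      \<bar>e_weight a G - a * (1 / 2) * ((real n)\<^sup>2 / 2)\<bar> \<le> \<gamma> * (real n)\<^sup>2
      \<longrightarrow> near_DTu2 G (\<beta> * (real n)\<^sup>2))"
  proof (intro exI[of _ \<tau>] conjI exI[of _ n0] allI impI \<tau>(1), elim conjE)
    fix G :: "'a pair_pre_digraph" and n :: nat
    assume G: "pair_digraph G" and n: "card (pverts G) = n" "n \<ge> n0"
      and free: "\<not> contains_copy G (blow_up T3 t)"
      and wt: "\<bar>e_weight a G - a * (1 / 2) * ((real n)\<^sup>2 / 2)\<bar> \<le> \<tau> * (real n)\<^sup>2"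
    interpret G: pair_digraph G by fact
    let ?V = "pverts G" and ?E = "parcs G"
    let ?D = "?E \<inter> ?E\<inverse>" and ?S = "?E \<union> ?E\<inverse> - ?E \<inter> ?E\<inverse>"
    have EV: "?E \<subseteq> ?V \<times> ?V" by (auto dest: G.in_arcsD1 G.in_arcsD2)
    have irr: "irrefl ?E" by (auto simp: irrefl_def dest: G.pair_no_loops)
    have tri: "card (tri ?E) \<le> \<tau>\<^sup>2 / 6 * card ?V ^ 3"
      using n by (intro n1 G free) (auto simp: n0_def)
    have "1 / \<tau> \<le> n" using n(2) unfolding n0_def by linarith
    then have \<tau>n: "1 \<le> \<tau> * card ?V" using \<tau>(1) n(1) by (simp add: field_simps)
    have D: "card ?D = 2 * f2 G"
    proof -
      have "{{u, v} | u v. u \<in> ?V \<and> v \<in> ?V \<and> u \<noteq> v \<and> (u, v) \<in> ?E \<and> (v, u) \<in> ?E}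
          = {{u, v} | u v. (u, v) \<in> ?D}"
      proof -
        have "u \<in> ?V \<and> v \<in> ?V \<and> u \<noteq> v \<and> (u, v) \<in> ?E \<and> (v, u) \<in> ?E \<longleftrightarrow> (u, v) \<in> ?D" for u v
          using EV irr by (auto simp: irrefl_def)
        then show ?thesis by presburger
      qed
      moreover have "sym ?D" "irrefl ?D" "finite ?D"
        using G.pair_finite_arcs irr by (auto simp: sym_def irrefl_def)
      ultimately show ?thesis
        using card_sym_eq_twice_card_pairs[of ?D] by (simp add: f2_def)
    qed
    have S: "card ?S = 2 * f1 G"
    proof -
      have "{{u, v} | u v. u \<in> ?V \<and> v \<in> ?V \<and> u \<noteq> v \<and> ((u, v) \<in> ?E \<longleftrightarrow> (v, u) \<notin> ?E)}
          = {{u, v} | u v. (u, v) \<in> ?S}"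
      proof -
        have "u \<in> ?V \<and> v \<in> ?V \<and> u \<noteq> v \<and> ((u, v) \<in> ?E \<longleftrightarrow> (v, u) \<notin> ?E) \<longleftrightarrow> (u, v) \<in> ?S" for u v
          using EV irr by (auto simp: irrefl_def)
        then show ?thesis by presburger
      qed
      moreover have "sym ?S" "irrefl ?S" "finite ?S"
        using G.pair_finite_arcs irr by (auto simp: sym_def irrefl_def)
      ultimately show ?thesis
        using card_sym_eq_twice_card_pairs[of ?S] by (simp add: f1_def)
    qed
    \<comment> \<open>Counting ordered pairs doubles \<open>e_weight\<close>, so
      \<open>a / 4 - \<tau>\<close> becomes \<open>a / 2 - 2 * \<tau>\<close>.\<close>
    have "a / 4 * (real n)\<^sup>2 - \<tau> * (real n)\<^sup>2 \<le> e_weight a G" using wt by simp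
    then have "(a / 2 - 2 * \<tau>) * (card ?V)\<^sup>2 \<le> a * card ?D + card ?S"
      by (simp add: D S n(1) e_weight_def algebra_simps)
    moreover have "?V \<noteq> {}" using n by (auto simp: n0_def)
    ultimately obtain A where A: "A \<subseteq> ?V" "card A = card ?V div 2"
      "card ((?E - bip A (?V - A)) \<union> (bip A (?V - A) - ?E)) \<le> 15 * sqrt \<sigma> * (card ?V)\<^sup>2"
      using near_bipartite_if_few_triangles[OF G.pair_finite_verts _ EV irr assms(1,2) \<tau>(1) \<tau>n \<tau>(2) \<sigma>(2) tri]
      by blast
    have "15 * sqrt \<sigma> * (real n)\<^sup>2 \<le> \<beta> * (real n)\<^sup>2"
      using \<sigma>(3) by (intro mult_right_mono) auto
    with A(3) have edit: "edit_distance G (double_bipartite A (?V - A)) \<le> \<beta> * (real n)\<^sup>2"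
      unfolding n(1) by (simp add: edit_distance_def double_bipartite_def bip_def)
    show "near_DTu2 G (\<beta> * (real n)\<^sup>2)"
      unfolding near_DTu2_def
    proof (rule exI[of _ A], rule exI[of _ "?V - A"], intro conjI)
      show "int (card A) = \<lfloor>real (card ?V) / 2\<rfloor>"
        unfolding A(2) by linarith
      have "card (?V - A) = card ?V - card ?V div 2"
        using A G.pair_finite_verts by (simp add: card_Diff_subset finite_subset)
      then show "int (card (?V - A)) = \<lceil>real (card ?V) / 2\<rceil>" by linarith
    qed (use A edit in auto)
  qed
qed

end
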